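(* Let $f$ be a real-valued function on $[a,b]$ with $f(x)>0$, except that $f(x)=0$ is allowed on a set of measure zero. Then the star-integral $M_a^b(f)$ of $f$ over $[a,b]$ is given by $$M_a^b(f)=\exp\left(\int_a^b \log(f(x))\,dx\right),$$ an identity between the two sides, both integrals being understood to exist.
   Context: A partition $P$ of $[a,b]$ is a choice of points $a=x_0<x_1<\dots<x_n=b$, with $\Delta x_i=x_i-x_{i-1}$ and $\mathrm{mesh}(P)=\max_i\Delta x_i$. A test set $T$ for $P$ is a choice of points $t_i$ with $x_{i-1}<t_i<x_i$ for $i=1,\dots,n$. Put $\mathcal{P}(f,P,T)=\prod_{i=1}^n f(t_i)^{\Delta x_i}$. The function $f$ is Riemann star-integrable on $[a,b]$ with star-integral $M\in\mathbb{R}$, written $M=M_a^b(f)$, if for every $\epsilon>0$ there is $\delta>0$ such that $\mathrm{mesh}(P)<\delta$ implies $|\mathcal{P}(f,P,T)-M|<\epsilon$. For equipartitions with $t_i=a+i\frac{b-a}{n}$ the star-integral is computed as $\lim_{n\to\infty}\left(\prod_{i=1}^n f\left(a+i\frac{b-a}{n}\right)\right)^{(b-a)/n}$. Here $\log$ is the natural logarithm. Where $f$ vanishes, $\log f$ is undefined and the integral of $\log f$ may have to be read as improper (as for $f(x)=x$ on $[0,1]$, where both sides equal $1/e$). *)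

theory Defs
  imports "HOL-Analysis.Analysis"
begin

definition is_partition :: "real \<Rightarrow> real \<Rightarrow> nat \<Rightarrow> (nat \<Rightarrow> real) \<Rightarrow> bool" where
  "is_partition a b n x \<longleftrightarrow> 1 \<le> n \<and> x 0 = a \<and> x n = b \<and> (\<forall>i\<in>{1..n}. x (i - 1) < x i)"

definition mesh :: "nat \<Rightarrow> (nat \<Rightarrow> real) \<Rightarrow> real" where
  "mesh n x = Max ((\<lambda>i. x i - x (i - 1)) ` {1..n})"

definition is_test_set :: "nat \<Rightarrow> (nat \<Rightarrow> real) \<Rightarrow> (nat \<Rightarrow> real) \<Rightarrow> bool" where
  "is_test_set n x t \<longleftrightarrow> (\<forall>i\<in>{1..n}. x (i - 1) < t i \<and> t i < x i)"

text \<open>Only used for functions with values \<open>\<ge> 0\<close>; note that \<open>0 powr d = 0\<close>.\<close>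

definition star_product :: "(real \<Rightarrow> real) \<Rightarrow> nat \<Rightarrow> (nat \<Rightarrow> real) \<Rightarrow> (nat \<Rightarrow> real) \<Rightarrow> real" where
  "star_product f n x t = (\<Prod>i=1..n. f (t i) powr (x i - x (i - 1)))"

definition has_star_integral :: "(real \<Rightarrow> real) \<Rightarrow> real \<Rightarrow> real \<Rightarrow> real \<Rightarrow> bool" where
  "has_star_integral f a b M \<longleftrightarrow>
     (\<forall>\<epsilon>>0. \<exists>\<delta>>0. \<forall>n x t. is_partition a b n x \<and> is_test_set n x t \<and> mesh n x < \<delta>
        \<longrightarrow> \<bar>star_product f n x t - M\<bar> < \<epsilon>)"

text \<open>
  If \<open>f\<close> tends to \<open>0\<close> at some point, a test point there can make the product arbitrarily small,
  so for example \<open>f x = x\<close> on \<open>[0,1]\<close> has the value \<open>1/e\<close> only as an improper star-integral,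
  in the same sense in which \<open>\<integral>\<^sub>0\<^sup>1 log x dx\<close> is an improper Riemann integral: cut
  \<open>[a,b]\<close> at finitely many points, take limits at the ends of each piece, and multiply.
\<close>

definition has_star_integral_open :: "(real \<Rightarrow> real) \<Rightarrow> real \<Rightarrow> real \<Rightarrow> real \<Rightarrow> bool" where
  "has_star_integral_open f a b N \<longleftrightarrow>
     (\<exists>m. (\<forall>u v. a < u \<and> u < v \<and> v < b \<longrightarrow> has_star_integral f u v (m u v)) \<and>
          ((\<lambda>(u, v). m u v) \<longlongrightarrow> N) (at_right a \<times>\<^sub>F at_left b))"

definition has_improper_star_integral :: "(real \<Rightarrow> real) \<Rightarrow> real \<Rightarrow> real \<Rightarrow> real \<Rightarrow> bool" where
  "has_improper_star_integral f a b M \<longleftrightarrow>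
     (\<exists>k c N. is_partition a b k c \<and>
        (\<forall>i\<in>{1..k}. has_star_integral_open f (c (i - 1)) (c i) (N i)) \<and>
        M = (\<Prod>i=1..k. N i))"

text \<open>
  The integral of \<open>log f\<close> will be the Henstock-Kurzweil integral of \<open>\<lambda>x. ln (f x)\<close>. It extends the
  Riemann, improper Riemann and Lebesgue integrals, and it ignores null sets, so the value
  \<open>ln 0 = 0\<close> on the zero set of \<open>f\<close> is immaterial.
\<close>

end

(* On every cell of a partition, some point has ln f at least its mean over the cell, and
   some point has it at most the mean; both can be chosen in the interior and off the null set where
   f vanishes. Hence every partition admits two test sets whose products enclose the
   exponential of the integral. As the mesh tends to 0 both products tend to the star-integral.
   No boundedness of ln f is involved, so M = 0 is excluded along the way. The improper
   case follows by continuity and additivity of the integral. *)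
theory Submission
  imports Defs
begin

section \<open>Points at which a function reaches its mean, off a null set\<close>

text \<open>Otherwise the mean minus \<open>g\<close> would be positive almost everywhere on the
  interval and still have integral 0. A nonnegative function with integral 0 vanishes almost
  everywhere, so the interval itself would be a null set.\<close>

lemma exists_ge_mean:
  fixes g :: "real \<Rightarrow> real"
  assumes "u < v" and g: "g integrable_on {u..v}" and N: "negligible N"
  obtains t where "t \<in> {u<..<v} - N" "integral {u..v} g \<le> (v - u) * g t"
proof (rule ccontr)
  assume "\<not> thesis"
  with that have less: "(v - u) * g t < integral {u..v} g" if "t \<in> {u<..<v} - N" for t
    using \<open>t \<in> {u<..<v} - N\<close> by force
  \<comment> \<open>The negated claim speaks only of interior points, so the endpoints join the
    exceptional set.\<close>
  define N' where "N' = N \<union> {u, v}"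
  have N': "negligible N'"
    using N by (simp add: N'_def negligible_Un)
  define k where "k x = integral {u..v} g - (v - u) * g x" for x
  \<comment> \<open>Resetting \<open>k\<close> to 0 on \<open>N'\<close> keeps its integral and
    makes it nonnegative on all of \<open>{u..v}\<close>.\<close>
  define h where "h x = (if x \<in> N' then 0 else k x)" for x
  have "(k has_integral (v - u) * integral {u..v} g - (v - u) * integral {u..v} g) {u..v}"
    unfolding k_def using has_integral_const_real[of "integral {u..v} g" u v] \<open>u < v\<close>
    by (intro has_integral_diff has_integral_mult_right integrable_integral g) simp
  then have h0: "(h has_integral 0) {u..v}"
    by (subst has_integral_spike_eq[OF N', of _ k]) (auto simp: h_def)
  have pos: "h x > 0" if "x \<in> {u..v} - N'" for x
    using less[of x] that by (auto simp: h_def k_def N'_def)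
  have nonneg: "h x \<ge> 0" if "x \<in> {u..v}" for x
    using pos[of x] that by (force simp: h_def)
  \<comment> \<open>Nonnegativity turns gauge integrability into Lebesgue integrability, where
    integral 0 forces \<open>h\<close> to vanish almost everywhere.\<close>
  have "h absolutely_integrable_on {u..v}"
    using h0 nonneg by (intro nonnegative_absolutely_integrable_1) auto
  then have int: "integrable (lebesgue_on {u..v}) h"
    by (simp add: absolutely_integrable_on_def set_integrable_def integrable_restrict_space)
  moreover have "integral\<^sup>L (lebesgue_on {u..v}) h = 0"
    using int h0 by (simp add: lebesgue_integral_eq_integral integral_unique)
  ultimately have "AE x in lebesgue_on {u..v}. h x = 0"
    by (subst (asm) integral_nonneg_eq_0_iff_AE) (auto simp: nonneg)
  then have "AE x in lebesgue. x \<in> {u..v} \<longrightarrow> h x = 0"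
    by (simp add: AE_restrict_space_iff)
  then obtain Z where "Z \<in> null_sets lebesgue" "{x. \<not> (x \<in> {u..v} \<longrightarrow> h x = 0)} \<subseteq> Z"
    unfolding eventually_ae_filter by auto
  then have "negligible {x. \<not> (x \<in> {u..v} \<longrightarrow> h x = 0)}"
    by (metis negligible_iff_null_sets negligible_subset)
  with N' have "negligible ({x. \<not> (x \<in> {u..v} \<longrightarrow> h x = 0)} \<union> N')"
    by (rule negligible_Un[rotated])
  \<comment> \<open>Off \<open>N'\<close> the function \<open>h\<close> is positive, so the two null
    sets cover the whole interval.\<close>
  then have "negligible {u..v}"
    by (rule negligible_subset) (use pos in force)
  with \<open>u < v\<close> show False
    using negligible_interval(1)[of u v] by simp
qed

lemma exists_le_mean:
  fixes g :: "real \<Rightarrow> real"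
  assumes "u < v" and "g integrable_on {u..v}" and "negligible N"
  obtains t where "t \<in> {u<..<v} - N" "(v - u) * g t \<le> integral {u..v} g"
  using exists_ge_mean[of u v "\<lambda>x. - g x" N] assms by (auto simp: integrable_neg)

section \<open>Partitions and additivity of the integral\<close>

lemma chain_le:
  fixes x :: "nat \<Rightarrow> real"
  assumes "\<And>i. i \<in> {1..n} \<Longrightarrow> x (i - 1) \<le> x i" and "i \<le> j" "j \<le> n"
  shows "x i \<le> x j"
  using assms(2,3)
proof (induction j rule: dec_induct)
  case (step j)
  then show ?case using assms(1)[of "Suc j"] by auto
qed simp

text \<open>Induction that splits off the last cell. It is stated for chains rather than through
  \<open>is_partition\<close>, which demands \<open>1 \<le> n\<close>, so that it can start at
  \<open>n = 0\<close>.\<close>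

lemma integral_sum_chain:
  fixes g :: "real \<Rightarrow> 'a :: banach" and x :: "nat \<Rightarrow> real"
  assumes "\<And>i. i \<in> {1..n} \<Longrightarrow> x (i - 1) \<le> x i" and "g integrable_on {x 0..x n}"
  shows "integral {x 0..x n} g = (\<Sum>i=1..n. integral {x (i - 1)..x i} g)"
  using assms
proof (induction n)
  case (Suc n)
  have le: "x 0 \<le> x n" "x n \<le> x (Suc n)"
    using chain_le[of "Suc n" x, OF Suc.prems(1)] by auto
  then have "g integrable_on {x 0..x n}"
    using integrable_subinterval_real[OF Suc.prems(2)] by auto
  with Suc have "integral {x 0..x n} g = (\<Sum>i=1..n. integral {x (i - 1)..x i} g)"
    by simp
  with Henstock_Kurzweil_Integration.integral_combine[OF le Suc.prems(2)] show ?case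
    by simp
qed simp

lemma partition_cell:
  assumes "is_partition a b n x" and "i \<in> {1..n}"
  shows "a \<le> x (i - 1)" "x (i - 1) < x i" "x i \<le> b"
proof -
  have mono: "x j \<le> x k" if "j \<le> k" "k \<le> n" for j k
    using chain_le[of n x j k] assms that by (auto simp: is_partition_def less_imp_le)
  show "a \<le> x (i - 1)" "x (i - 1) < x i" "x i \<le> b"
    using mono[of 0 "i - 1"] mono[of i n] assms by (auto simp: is_partition_def)
qed

lemma integral_partition:
  fixes g :: "real \<Rightarrow> 'a :: banach"
  assumes "is_partition a b n x" and "g integrable_on {a..b}"
  shows "integral {a..b} g = (\<Sum>i=1..n. integral {x (i - 1)..x i} g)"
  using integral_sum_chain[of n x g] assms by (auto simp: is_partition_def less_imp_le)

text \<open>Ensures that the mesh condition in \<open>has_star_integral\<close> is never vacuous.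
  The witness is the equipartition into more than \<open>(b - a) / \<delta>\<close> cells.\<close>

lemma exists_fine_partition:
  assumes "a < b" "0 < \<delta>"
  obtains n x where "is_partition a b n x" "mesh n x < \<delta>"
proof -
  obtain n :: nat where n: "(b - a) / \<delta> < real n"
    using reals_Archimedean2 by blast
  have "0 < (b - a) / \<delta>"
    using assms by simp
  with n have n0: "0 < n"
    by (metis less_trans of_nat_0_less_iff)
  define x where "x i = a + real i * ((b - a) / real n)" for i
  have step: "x i - x (i - 1) = (b - a) / real n" if "i \<in> {1..n}" for i
    using that by (simp add: x_def of_nat_diff algebra_simps diff_divide_distrib)
  have "is_partition a b n x"
    unfolding is_partition_def
  proof (intro conjI ballI)
    fix i assume "i \<in> {1..n}"
    then have "0 < x i - x (i - 1)"
      using step[of i] assms n0 by simp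
    then show "x (i - 1) < x i"
      by simp
  qed (use n0 in \<open>auto simp: x_def\<close>)
  moreover have "mesh n x < \<delta>"
    unfolding mesh_def
  proof (subst Max_less_iff)
    have "(b - a) / real n < \<delta>"
      using n n0 assms by (simp add: field_simps)
    then show "\<forall>d\<in>(\<lambda>i. x i - x (i - 1)) ` {1..n}. d < \<delta>"
      using step by simp
  qed (use n0 in auto)
  ultimately show ?thesis
    by (rule that)
qed

section \<open>The proper star-integral\<close>

text \<open>At a nonzero base \<open>powr\<close> is \<open>exp\<close> of the exponent times
  \<open>ln\<close> of the base; at base 0 it is 0, a value that \<open>exp\<close> never
  takes.\<close>

lemma star_product_eq_exp_sum:
  assumes "\<And>i. i \<in> {1..n} \<Longrightarrow> f (t i) \<noteq> 0"
  shows "star_product f n x t = exp (\<Sum>i=1..n. (x i - x (i - 1)) * ln (f (t i)))"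
  using assms by (simp add: star_product_def exp_sum powr_def)

text \<open>The comparisons with the mean on each cell add up to a comparison of the exponents, and
  \<open>exp\<close> is monotone.\<close>

lemma exists_star_products_enclosing:
  fixes f :: "real \<Rightarrow> real"
  assumes P: "is_partition a b n x"
    and null: "negligible {x \<in> {a..b}. f x = 0}"
    and int: "(\<lambda>x. ln (f x)) integrable_on {a..b}"
  obtains s t where "is_test_set n x s" "is_test_set n x t"
    "star_product f n x s \<le> exp (integral {a..b} (\<lambda>x. ln (f x)))"
    "exp (integral {a..b} (\<lambda>x. ln (f x))) \<le> star_product f n x t"
proof -
  let ?N = "{x \<in> {a..b}. f x = 0}" and ?g = "\<lambda>x. ln (f x)"
  note cell = partition_cell[OF P]
  have int': "?g integrable_on {x (i - 1)..x i}" if "i \<in> {1..n}" for i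
    using integrable_subinterval_real[OF int] cell[OF that] by auto
  have "\<forall>i\<in>{1..n}. \<exists>s. s \<in> {x (i - 1)<..<x i} - ?N \<and>
      (x i - x (i - 1)) * ?g s \<le> integral {x (i - 1)..x i} ?g"
    by (intro ballI, rule exists_le_mean[OF cell(2) int' null]) blast+
  from bchoice[OF this] obtain s where s: "\<And>i. i \<in> {1..n} \<Longrightarrow> s i \<in> {x (i - 1)<..<x i} - ?N"
    "\<And>i. i \<in> {1..n} \<Longrightarrow> (x i - x (i - 1)) * ?g (s i) \<le> integral {x (i - 1)..x i} ?g"
    by blast
  have "\<forall>i\<in>{1..n}. \<exists>t. t \<in> {x (i - 1)<..<x i} - ?N \<and>
      integral {x (i - 1)..x i} ?g \<le> (x i - x (i - 1)) * ?g t"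
    by (intro ballI, rule exists_ge_mean[OF cell(2) int' null]) blast+
  from bchoice[OF this] obtain t where t: "\<And>i. i \<in> {1..n} \<Longrightarrow> t i \<in> {x (i - 1)<..<x i} - ?N"
    "\<And>i. i \<in> {1..n} \<Longrightarrow> integral {x (i - 1)..x i} ?g \<le> (x i - x (i - 1)) * ?g (t i)"
    by blast
  \<comment> \<open>\<open>?N\<close> contains only the zeros inside \<open>{a..b}\<close>, so the
    cells must be known to lie there.\<close>
  have "f (s i) \<noteq> 0" "f (t i) \<noteq> 0" if "i \<in> {1..n}" for i
    using s(1)[OF that] t(1)[OF that] cell[OF that] by auto
  then have "star_product f n x s = exp (\<Sum>i=1..n. (x i - x (i - 1)) * ?g (s i))"
    "star_product f n x t = exp (\<Sum>i=1..n. (x i - x (i - 1)) * ?g (t i))"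
    by (intro star_product_eq_exp_sum; blast)+
  moreover have "(\<Sum>i=1..n. (x i - x (i - 1)) * ?g (s i)) \<le> integral {a..b} ?g"
    "integral {a..b} ?g \<le> (\<Sum>i=1..n. (x i - x (i - 1)) * ?g (t i))"
    unfolding integral_partition[OF P int] using s(2) t(2) by (auto intro!: sum_mono)
  moreover have "is_test_set n x s" "is_test_set n x t"
    using s(1) t(1) by (auto simp: is_test_set_def)
  ultimately show ?thesis
    using that by simp
qed

lemma has_star_integral_eq_exp:
  fixes f :: "real \<Rightarrow> real"
  assumes "a < b"
    and null: "negligible {x \<in> {a..b}. f x = 0}"
    and int: "(\<lambda>x. ln (f x)) integrable_on {a..b}"
    and star: "has_star_integral f a b M"
  shows "M = exp (integral {a..b} (\<lambda>x. ln (f x)))"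
proof -
  have "dist M (exp (integral {a..b} (\<lambda>x. ln (f x)))) < \<epsilon>" if "\<epsilon> > 0" for \<epsilon>
  proof -
    obtain \<delta> where "\<delta> > 0" and close:
      "\<And>n x t. is_partition a b n x \<Longrightarrow> is_test_set n x t \<Longrightarrow> mesh n x < \<delta>
        \<Longrightarrow> \<bar>star_product f n x t - M\<bar> < \<epsilon>"
      using star[unfolded has_star_integral_def, rule_format, OF \<open>\<epsilon> > 0\<close>] by auto
    obtain n x where P: "is_partition a b n x" "mesh n x < \<delta>"
      using exists_fine_partition[OF \<open>a < b\<close> \<open>\<delta> > 0\<close>] .
    obtain s t where st: "is_test_set n x s" "is_test_set n x t"
      and le: "star_product f n x s \<le> exp (integral {a..b} (\<lambda>x. ln (f x)))"
        "exp (integral {a..b} (\<lambda>x. ln (f x))) \<le> star_product f n x t"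
      using exists_star_products_enclosing[OF P(1) null int] .
    \<comment> \<open>Both products lie within \<open>\<epsilon>\<close> of \<open>M\<close>, hence
      so does the exponential between them.\<close>
    have "\<bar>star_product f n x s - M\<bar> < \<epsilon>" "\<bar>star_product f n x t - M\<bar> < \<epsilon>"
      by (rule close[OF P(1) _ P(2)]; fact st)+
    with le show ?thesis
      unfolding dist_real_def by linarith
  qed
  \<comment> \<open>With the distance itself as \<open>\<epsilon>\<close>, a positive distance would
    be less than itself.\<close>
  from this[of "dist M (exp (integral {a..b} (\<lambda>x. ln (f x))))"] show ?thesis
    by (meson less_irrefl zero_less_dist_iff)
qed

section \<open>Limits at the endpoints\<close>

text \<open>The integral over \<open>{u..v}\<close> is a difference of two values of the indefinite
  integral, which is continuous up to both endpoints even if \<open>g\<close> is unbounded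
  there.\<close>

lemma tendsto_integral_inner:
  fixes g :: "real \<Rightarrow> 'a :: banach"
  assumes "a < b" and g: "g integrable_on {a..b}"
  shows "((\<lambda>(u, v). integral {u..v} g) \<longlongrightarrow> integral {a..b} g) (at_right a \<times>\<^sub>F at_left b)"
proof -
  have fst_lim: "filterlim fst (at_right a) (at_right a \<times>\<^sub>F at_left b)"
    and snd_lim: "filterlim snd (at_left b) (at_right a \<times>\<^sub>F at_left b)"
    by (simp_all add: filterlim_def filtermap_fst_prod_filter filtermap_snd_prod_filter)
  have "((\<lambda>u. integral {a..u} g) \<longlongrightarrow> integral {a..a} g) (at_right a)"
    using indefinite_integral_continuous_1[OF g] \<open>a < b\<close>
    by (metis continuous_on_Icc_at_rightD)
  then have "((\<lambda>p. integral {a..fst p} g) \<longlongrightarrow> 0) (at_right a \<times>\<^sub>F at_left b)"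
    using filterlim_compose[OF _ fst_lim] by simp
  moreover have "((\<lambda>v. integral {a..v} g) \<longlongrightarrow> integral {a..b} g) (at_left b)"
    using indefinite_integral_continuous_1[OF g] \<open>a < b\<close>
    by (metis continuous_on_Icc_at_leftD)
  then have "((\<lambda>p. integral {a..snd p} g) \<longlongrightarrow> integral {a..b} g) (at_right a \<times>\<^sub>F at_left b)"
    by (rule filterlim_compose[OF _ snd_lim])
  ultimately have "((\<lambda>p. integral {a..snd p} g - integral {a..fst p} g) \<longlongrightarrow> integral {a..b} g - 0)
      (at_right a \<times>\<^sub>F at_left b)"
    by (rule tendsto_diff[rotated])
  moreover have "eventually (\<lambda>p. integral {a..snd p} g - integral {a..fst p} g
      = (case p of (u, v) \<Rightarrow> integral {u..v} g)) (at_right a \<times>\<^sub>F at_left b)"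
    unfolding eventually_prod_filter
  proof (intro exI conjI allI impI)
    \<comment> \<open>The product filter does not relate \<open>u\<close> to \<open>v\<close>;
      keeping them on opposite sides of the midpoint gives \<open>u < v\<close>.\<close>
    show "eventually (\<lambda>u. u \<in> {a<..<(a + b) / 2}) (at_right a)"
      using \<open>a < b\<close> by (intro eventually_at_right_real) simp
    show "eventually (\<lambda>v. v \<in> {(a + b) / 2<..<b}) (at_left b)"
      using \<open>a < b\<close> by (intro eventually_at_left_real) simp
    fix u v assume uv: "u \<in> {a<..<(a + b) / 2}" "v \<in> {(a + b) / 2<..<b}"
    then have "g integrable_on {a..v}"
      using integrable_subinterval_real[OF g] by auto
    with uv have "integral {a..u} g + integral {u..v} g = integral {a..v} g"
      by (intro Henstock_Kurzweil_Integration.integral_combine) auto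
    then show "integral {a..snd (u, v)} g - integral {a..fst (u, v)} g
        = (case (u, v) of (u, v) \<Rightarrow> integral {u..v} g)"
      by (simp add: algebra_simps)
  qed
  ultimately show ?thesis
    by (simp add: tendsto_cong)
qed

text \<open>The proper case determines \<open>m u v\<close> on every inner interval, so
  \<open>N\<close> and the claimed value are limits of the same function.\<close>

lemma has_star_integral_open_eq_exp:
  fixes f :: "real \<Rightarrow> real"
  assumes "a < b"
    and null: "negligible {x \<in> {a..b}. f x = 0}"
    and int: "(\<lambda>x. ln (f x)) integrable_on {a..b}"
    and star: "has_star_integral_open f a b N"
  shows "N = exp (integral {a..b} (\<lambda>x. ln (f x)))"
proof -
  let ?F = "at_right a \<times>\<^sub>F at_left b"
  obtain m where m: "\<And>u v. a < u \<Longrightarrow> u < v \<Longrightarrow> v < b \<Longrightarrow> has_star_integral f u v (m u v)"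
    and lim: "((\<lambda>(u, v). m u v) \<longlongrightarrow> N) ?F"
    using star unfolding has_star_integral_open_def by blast
  have m_eq: "m u v = exp (integral {u..v} (\<lambda>x. ln (f x)))" if "a < u" "u < v" "v < b" for u v
  proof (rule has_star_integral_eq_exp[OF \<open>u < v\<close> _ _ m[OF that]])
    show "negligible {x \<in> {u..v}. f x = 0}"
      using that by (intro negligible_subset[OF null]) auto
    show "(\<lambda>x. ln (f x)) integrable_on {u..v}"
      using that by (intro integrable_subinterval_real[OF int]) auto
  qed
  have "eventually (\<lambda>p. exp (case p of (u, v) \<Rightarrow> integral {u..v} (\<lambda>x. ln (f x)))
      = (case p of (u, v) \<Rightarrow> m u v)) ?F"
    unfolding eventually_prod_filter
  proof (intro exI conjI allI impI)
    show "eventually (\<lambda>u. u \<in> {a<..<(a + b) / 2}) (at_right a)"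
      using \<open>a < b\<close> by (intro eventually_at_right_real) simp
    show "eventually (\<lambda>v. v \<in> {(a + b) / 2<..<b}) (at_left b)"
      using \<open>a < b\<close> by (intro eventually_at_left_real) simp
  qed (use m_eq in auto)
  moreover have "((\<lambda>p. exp (case p of (u, v) \<Rightarrow> integral {u..v} (\<lambda>x. ln (f x))))
      \<longlongrightarrow> exp (integral {a..b} (\<lambda>x. ln (f x)))) ?F"
    by (intro tendsto_exp tendsto_integral_inner[OF \<open>a < b\<close> int])
  ultimately have "((\<lambda>(u, v). m u v) \<longlongrightarrow> exp (integral {a..b} (\<lambda>x. ln (f x)))) ?F"
    by (simp add: tendsto_cong)
  \<comment> \<open>Limits are unique only along a nontrivial filter.\<close>
  moreover have "?F \<noteq> bot"
    by (simp add: prod_filter_eq_bot)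
  ultimately show ?thesis
    using tendsto_unique lim by blast
qed

section \<open>The identity for proper and improper star-integrals\<close>

theorem mainTheorem1:
  fixes f :: "real \<Rightarrow> real" and a b M :: real
  assumes "a < b"
    and "\<And>x. x \<in> {a..b} \<Longrightarrow> 0 \<le> f x"
    and "negligible {x \<in> {a..b}. f x = 0}"
    and "has_star_integral f a b M \<or> has_improper_star_integral f a b M"
    and "(\<lambda>x. ln (f x)) integrable_on {a..b}"
  shows "M = exp (integral {a..b} (\<lambda>x. ln (f x)))"
  using assms(4)
proof
  assume "has_star_integral f a b M"
  with assms(1,3,5) show ?thesis
    by (intro has_star_integral_eq_exp)
next
  assume "has_improper_star_integral f a b M"
  then obtain k c N where P: "is_partition a b k c"
    and N: "\<And>i. i \<in> {1..k} \<Longrightarrow> has_star_integral_open f (c (i - 1)) (c i) (N i)"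
    and M: "M = (\<Prod>i=1..k. N i)"
    unfolding has_improper_star_integral_def by blast
  \<comment> \<open>Each piece inherits integrability and the null zero set; multiplying the
    exponentials then adds the integrals over the pieces.\<close>
  have "N i = exp (integral {c (i - 1)..c i} (\<lambda>x. ln (f x)))" if i: "i \<in> {1..k}" for i
  proof (rule has_star_integral_open_eq_exp[OF partition_cell(2)[OF P i] _ _ N[OF i]])
    note cell = partition_cell[OF P i]
    show "negligible {x \<in> {c (i - 1)..c i}. f x = 0}"
      using cell by (intro negligible_subset[OF assms(3)]) auto
    show "(\<lambda>x. ln (f x)) integrable_on {c (i - 1)..c i}"
      using cell by (intro integrable_subinterval_real[OF assms(5)]) auto
  qed
  then show ?thesis
    by (simp add: M integral_partition[OF P assms(5)] exp_sum)
qed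

end
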